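(* Suppose that $f\colon[0,1]\to[0,1]$ is continuous, let $\mathcal{C}$ be the set of critical points of $f$, and let $\Lambda\subset(0,1)$ be closed and strongly invariant (i.e. $f(\Lambda)=\Lambda$). Suppose further that: (1) the set $\mathcal{C}$ is closed and for every $\varepsilon>0$ there is some integer $m>0$ such that $f^{-m}(\mathcal{C})$ is an $\varepsilon$-net in $[0,1]$; (2) the Schwarzian derivative $S(f)(x)$ is defined and non-positive for all $x\in[0,1]\setminus\mathcal{C}$; (3) $\Lambda\cap\mathcal{C}=\emptyset$. Then $f$ has shadowing, s-limit shadowing and h-shadowing on $\Lambda$.
   Context: A critical point of a continuous map $f\colon[0,1]\to[0,1]$ is a point $x\in[0,1]$ at which $f$ fails to be locally one-to-one, i.e. there is no open subset $V\ni x$ of $[0,1]$ such that $f|_V$ is injective. $f^{-m}(\mathcal{C})=\{x: f^m(x)\in\mathcal{C}\}$. For $\varepsilon>0$, a subset $N$ of a metric space $X$ is an $\varepsilon$-net if $N\cap B_\varepsilon(y)\ne\emptyset$ for all $y\in X$, where $B_\varepsilon(y)$ is the open $\varepsilon$-ball. The Schwarzian derivative of $f$ at $x$ is $$S(f)(x)=\frac{f'''(x)}{f'(x)}-\frac32\left(\frac{f''(x)}{f'(x)}\right)^2 .$$ Let $X=[0,1]$ with the usual metric $d$, and $\mathbb{N}=\{0,1,2,\dots\}$. For $\varepsilon>0$, a finite or infinite sequence $x_0,x_1,\dots$ in $X$ is an $\varepsilon$-pseudo-orbit if $d(f(x_n),x_{n+1})<\varepsilon$ for all $n\ge0$ (for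 which both terms are defined). An infinite $\varepsilon$-pseudo-orbit is an asymptotic $\varepsilon$-pseudo-orbit if in addition $d(f(x_n),x_{n+1})\to0$ as $n\to\infty$. A point $y\in X$ $\varepsilon$-shadows $\{x_n\}$ if $d(f^n(y),x_n)<\varepsilon$ for every index $n$; it asymptotically $\varepsilon$-shadows $\{x_n\}_{n\in\mathbb{N}}$ if in addition $\lim_{n\to\infty}d(f^n(y),x_n)=0$. Let $Y\subseteq X$. - $f$ has shadowing on $Y$ if for every $\varepsilon>0$ there is $\delta>0$ such that every infinite $\delta$-pseudo-orbit in $Y$ is $\varepsilon$-shadowed by a point $y\in X$. - $f$ has s-limit shadowing on $Y$ if for every $\varepsilon>0$ there is $\delta>0$ such that (i) every infinite $\delta$-pseudo-orbit in $Y$ is $\varepsilon$-shadowed by some $y\in X$, and (ii) every asymptotic $\delta$-pseudo-orbit in $Y$ is asymptotically $\varepsilon$-shadowed by some $y\in X$. - $f$ has h-shadowing on $Y$ if for every $\varepsilon>0$ there is $\delta>0$ such that for every finite $\delta$-pseudo-orbit $\{x_0,\dots,x_m\}\subseteq Y$ there is $y\in X$ with $d(f^i(y),x_i)<\varepsilon$ for every $i<m$ and $f^m(y)=x_m$. *)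

theory Defs
  imports "HOL-Analysis.Analysis"
begin

text \<open>
  A self-map of a space \<open>X\<close> is represented by a total function together with the carrier
  set \<open>X\<close>; its values outside \<open>X\<close> are irrelevant.
\<close>

definition critical_points ::
    "'a::topological_space set \<Rightarrow> ('a \<Rightarrow> 'b) \<Rightarrow> 'a set" where
  "critical_points X f =
     {x \<in> X. \<not> (\<exists>V. openin (top_of_set X) V \<and> x \<in> V \<and> inj_on f V)}"

definition is_net :: "real \<Rightarrow> 'a::metric_space set \<Rightarrow> 'a set \<Rightarrow> bool" where
  "is_net \<epsilon> X N \<longleftrightarrow> N \<subseteq> X \<and> (\<forall>y\<in>X. N \<inter> ball y \<epsilon> \<noteq> {})"


subsection \<open>The Schwarzian derivative\<close>

text \<open>
  Derivatives are taken relative to the domain \<open>X\<close>; for \<open>X = {0..1}\<close> they are one-sided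
  at the two endpoints.
\<close>

definition deriv_on :: "real set \<Rightarrow> (real \<Rightarrow> real) \<Rightarrow> real \<Rightarrow> real" where
  "deriv_on X f x = vector_derivative f (at x within X)"

definition schwarzian :: "real set \<Rightarrow> (real \<Rightarrow> real) \<Rightarrow> real \<Rightarrow> real" where
  "schwarzian X f x =
     (deriv_on X ^^ 3) f x / deriv_on X f x
     - 3 / 2 * ((deriv_on X ^^ 2) f x / deriv_on X f x)\<^sup>2"

text \<open>
  For the third derivative at \<open>x\<close> to make sense, the first two derivatives have to exist
  in a neighbourhood of \<open>x\<close> in \<open>X\<close>. The first derivative must not vanish at \<open>x\<close>, since
  it occurs as a denominator.
\<close>

definition schwarzian_defined :: "real set \<Rightarrow> (real \<Rightarrow> real) \<Rightarrow> real \<Rightarrow> bool" where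
  "schwarzian_defined X f x \<longleftrightarrow>
     (\<exists>V. openin (top_of_set X) V \<and> x \<in> V \<and>
        (\<forall>y\<in>V. f differentiable (at y within X) \<and>
                deriv_on X f differentiable (at y within X))) \<and>
     (deriv_on X ^^ 2) f differentiable (at x within X) \<and>
     deriv_on X f x \<noteq> 0"


subsection \<open>Pseudo-orbits and shadowing\<close>

definition pseudo_orbit :: "('a::metric_space \<Rightarrow> 'a) \<Rightarrow> real \<Rightarrow> (nat \<Rightarrow> 'a) \<Rightarrow> bool" where
  "pseudo_orbit f \<delta> x \<longleftrightarrow> (\<forall>n. dist (f (x n)) (x (Suc n)) < \<delta>)"

text \<open>The finite sequence \<open>x 0, \<dots>, x m\<close>; the values of \<open>x\<close> beyond \<open>m\<close> play no role.\<close>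

definition finite_pseudo_orbit ::
    "('a::metric_space \<Rightarrow> 'a) \<Rightarrow> real \<Rightarrow> nat \<Rightarrow> (nat \<Rightarrow> 'a) \<Rightarrow> bool" where
  "finite_pseudo_orbit f \<delta> m x \<longleftrightarrow> (\<forall>n<m. dist (f (x n)) (x (Suc n)) < \<delta>)"

definition asymptotic_pseudo_orbit ::
    "('a::metric_space \<Rightarrow> 'a) \<Rightarrow> real \<Rightarrow> (nat \<Rightarrow> 'a) \<Rightarrow> bool" where
  "asymptotic_pseudo_orbit f \<delta> x \<longleftrightarrow>
     pseudo_orbit f \<delta> x \<and> (\<lambda>n. dist (f (x n)) (x (Suc n))) \<longlonglongrightarrow> 0"

definition shadows ::
    "('a::metric_space \<Rightarrow> 'a) \<Rightarrow> real \<Rightarrow> 'a \<Rightarrow> (nat \<Rightarrow> 'a) \<Rightarrow> bool" where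
  "shadows f \<epsilon> y x \<longleftrightarrow> (\<forall>n. dist ((f ^^ n) y) (x n) < \<epsilon>)"

definition asymptotically_shadows ::
    "('a::metric_space \<Rightarrow> 'a) \<Rightarrow> real \<Rightarrow> 'a \<Rightarrow> (nat \<Rightarrow> 'a) \<Rightarrow> bool" where
  "asymptotically_shadows f \<epsilon> y x \<longleftrightarrow>
     shadows f \<epsilon> y x \<and> (\<lambda>n. dist ((f ^^ n) y) (x n)) \<longlonglongrightarrow> 0"

definition shadowing_on ::
    "'a::metric_space set \<Rightarrow> ('a \<Rightarrow> 'a) \<Rightarrow> 'a set \<Rightarrow> bool" where
  "shadowing_on X f Y \<longleftrightarrow>
     (\<forall>\<epsilon>>0. \<exists>\<delta>>0. \<forall>x. range x \<subseteq> Y \<and> pseudo_orbit f \<delta> x \<longrightarrow>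
        (\<exists>y\<in>X. shadows f \<epsilon> y x))"

definition s_limit_shadowing_on ::
    "'a::metric_space set \<Rightarrow> ('a \<Rightarrow> 'a) \<Rightarrow> 'a set \<Rightarrow> bool" where
  "s_limit_shadowing_on X f Y \<longleftrightarrow>
     (\<forall>\<epsilon>>0. \<exists>\<delta>>0.
        (\<forall>x. range x \<subseteq> Y \<and> pseudo_orbit f \<delta> x \<longrightarrow>
           (\<exists>y\<in>X. shadows f \<epsilon> y x)) \<and>
        (\<forall>x. range x \<subseteq> Y \<and> asymptotic_pseudo_orbit f \<delta> x \<longrightarrow>
           (\<exists>y\<in>X. asymptotically_shadows f \<epsilon> y x)))"

definition h_shadowing_on ::
    "'a::metric_space set \<Rightarrow> ('a \<Rightarrow> 'a) \<Rightarrow> 'a set \<Rightarrow> bool" where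
  "h_shadowing_on X f Y \<longleftrightarrow>
     (\<forall>\<epsilon>>0. \<exists>\<delta>>0. \<forall>m x. x ` {..m} \<subseteq> Y \<and> finite_pseudo_orbit f \<delta> m x \<longrightarrow>
        (\<exists>y\<in>X. (\<forall>i<m. dist ((f ^^ i) y) (x i) < \<epsilon>) \<and> (f ^^ m) y = x m))"

end

theory Submission
  imports Defs
begin

text \<open>
  An interval on which some iterate \<open>f\<^sup>n\<close> is injective contains no point of
  \<open>f\<^sup>-\<^sup>k(C)\<close> with \<open>k < n\<close> in its interior, so by the net condition such intervals shrink
  uniformly as \<open>n\<close> grows. Near \<open>\<Lambda>\<close> the map \<open>f\<close> is injective on intervals of a fixed
  radius, so a point that stays close to an orbit in \<open>\<Lambda>\<close> for a long time starts close to it: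
  \<open>f\<close> is uniformly expansive along \<open>\<Lambda>\<close>. Moreover \<open>f\<close> is uniformly open at the points
  of \<open>\<Lambda>\<close>. Hence the last point of a pseudo-orbit can be pulled back along it
  step by step: openness yields the next preimage within a crude distance, and expansivity
  improves the crude distance to the required one. This is h-shadowing; shadowing follows by
  compactness, and expansivity makes the shadowing asymptotic.
\<close>

section \<open>Critical points and injectivity on intervals\<close>

text \<open>If two points \<open>u < v\<close> had the same value, \<open>f\<close> would have an
  extremum over \<open>{u..v}\<close> at an interior point. That point is not critical, so
  \<open>f\<close> is injective, hence strictly monotone, around it, which rules out an
  extremum.\<close>

lemma inj_on_if_no_critical_points:
  fixes f :: "real \<Rightarrow> real"
  assumes cont: "continuous_on X f" and sub: "{a..b} \<subseteq> X" and nc: "{a..b} \<inter> critical_points X f = {}"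
  shows "inj_on f {a..b}"
proof -
  have neq: "f u \<noteq> f v" if uv: "a \<le> u" "u < v" "v \<le> b" for u v
  proof
    assume eq: "f u = f v"
    have cuv: "continuous_on {u..v} f"
      by (rule continuous_on_subset[OF cont]) (use uv sub in auto)
    have ne: "{u..v} \<noteq> {}" using uv by auto
    obtain p where p: "p \<in> {u..v}" "\<And>y. y \<in> {u..v} \<Longrightarrow> f y \<le> f p"
      using continuous_attains_sup[OF compact_Icc ne cuv] by auto
    obtain q where q: "q \<in> {u..v}" "\<And>y. y \<in> {u..v} \<Longrightarrow> f q \<le> f y"
      using continuous_attains_inf[OF compact_Icc ne cuv] by auto
    have "\<exists>c. u < c \<and> c < v \<and> ((\<forall>y\<in>{u..v}. f y \<le> f c) \<or> (\<forall>y\<in>{u..v}. f c \<le> f y))"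
    proof (cases "p \<in> {u<..<v} \<or> q \<in> {u<..<v}")
      case True
      then show ?thesis using p(2) q(2) by (metis greaterThanLessThan_iff)
    next
      case False
      then have "p = u \<or> p = v" "q = u \<or> q = v" using p(1) q(1) by auto
      \<comment> \<open>Maximum and minimum agree, so \<open>f\<close> is constant on
        \<open>{u..v}\<close> and the midpoint serves as an interior extremum.\<close>
      then have pq: "f p = f q" using eq by auto
      have mid: "(u + v) / 2 \<in> {u..v}" using uv by simp
      have "f y \<le> f ((u + v) / 2)" if "y \<in> {u..v}" for y
        using p(2)[OF that] q(2)[OF mid] pq by linarith
      then show ?thesis using uv by (intro exI[of _ "(u + v) / 2"]) simp
    qed
    then obtain c where c: "u < c" "c < v"
      and ext: "(\<forall>y\<in>{u..v}. f y \<le> f c) \<or> (\<forall>y\<in>{u..v}. f c \<le> f y)" by blast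
    have "c \<in> {a..b}" using c uv by simp
    then have "c \<in> X" "c \<notin> critical_points X f" using sub nc by blast+
    then obtain V where V: "openin (top_of_set X) V" "c \<in> V" "inj_on f V"
      unfolding critical_points_def by blast
    then obtain e where e: "e > 0" "ball c e \<inter> X \<subseteq> V"
      unfolding openin_contains_ball by blast
    \<comment> \<open>Halving \<open>e\<close> fits a closed interval of radius \<open>d\<close>
      into the open ball; the other two bounds keep it inside \<open>{u..v}\<close>.\<close>
    define d where "d = min (e / 2) (min (c - u) (v - c))"
    have d: "d > 0" "d \<le> e / 2" "d \<le> c - u" "d \<le> v - c" using e c unfolding d_def by linarith+
    have sV: "{c - d..c + d} \<subseteq> V"
    proof
      fix t assume "t \<in> {c - d..c + d}"
      then have "t \<in> ball c e" "t \<in> X" using d e(1) sub uv by (auto simp: dist_real_def)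
      then show "t \<in> V" using e by blast
    qed
    have "continuous_on {c - d..c + d} f"
      by (rule continuous_on_subset[OF cuv]) (use d in auto)
    moreover have "inj_on f {c - d..c + d}" using V(3) sV by (rule inj_on_subset)
    ultimately have "f (c - d) < f c \<and> f c < f (c + d) \<or> f (c + d) < f c \<and> f c < f (c - d)"
      using continuous_inj_imp_mono[of "c - d" c "c + d" f] d by auto
    moreover have "c - d \<in> {u..v}" "c + d \<in> {u..v}" using d c by auto
    then have "f (c - d) \<le> f c \<and> f (c + d) \<le> f c \<or> f c \<le> f (c - d) \<and> f c \<le> f (c + d)"
      using ext by blast
    ultimately show False by linarith
  qed
  show ?thesis
  proof (rule linorder_inj_onI)
    show "f u \<noteq> f v" if "u < v" "u \<in> {a..b}" "v \<in> {a..b}" for u v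
      using neq[of u v] that by auto
  qed auto
qed

section \<open>Iterates and pseudo-orbits of interval maps\<close>

locale interval_map =
  fixes f :: "real \<Rightarrow> real"
  assumes cont: "continuous_on {0..1} f" and maps: "f ` {0..1} \<subseteq> {0..1}"
begin

lemma funpow_maps: "x \<in> {0..1} \<Longrightarrow> (f ^^ n) x \<in> {0..1}"
  by (induction n) (use maps in \<open>auto simp: image_subset_iff\<close>)

lemma funpow_cont: "continuous_on {0..1} (f ^^ n)"
proof (induction n)
  case (Suc n)
  have "continuous_on {0..1} (\<lambda>x. f ((f ^^ n) x))"
    by (rule continuous_on_compose2[OF cont Suc]) (use funpow_maps in blast)
  then show ?case by (simp add: comp_def)
qed simp

text \<open>The net condition puts a point \<open>z\<close> with \<open>(f ^^ m) z\<close> critical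
  into the interior of every interval of length at least \<open>\<epsilon>\<close>. If
  \<open>f ^^ Suc m\<close> were injective there, invariance of domain would make the image of the
  interior under \<open>f ^^ m\<close> an open neighbourhood of \<open>(f ^^ m) z\<close> on which
  \<open>f\<close> is injective.\<close>

lemma inj_iterate_small:
  assumes net: "\<forall>\<epsilon>>0. \<exists>m::nat. m > 0 \<and> is_net \<epsilon> {0..1} {x \<in> {0..1}. (f ^^ m) x \<in> critical_points {0..1} f}"
    and "\<epsilon> > 0"
  obtains N where "\<And>a b. {a..b} \<subseteq> {0..1} \<Longrightarrow> inj_on (f ^^ N) {a..b} \<Longrightarrow> b - a < \<epsilon>"
proof -
  obtain m where m: "is_net (\<epsilon>/2) {0..1} {x \<in> {0..1}. (f ^^ m) x \<in> critical_points {0..1} f}"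
    using net \<open>\<epsilon> > 0\<close> by (meson half_gt_zero)
  show ?thesis
  proof (rule that[of "Suc m"], rule ccontr)
    fix a b assume ab: "{a..b} \<subseteq> {0..1}" "inj_on (f ^^ Suc m) {a..b}" "\<not> b - a < \<epsilon>"
    have mid: "(a + b) / 2 \<in> {0..1}" using ab \<open>\<epsilon> > 0\<close> by auto
    then obtain z where z: "z \<in> ball ((a + b) / 2) (\<epsilon>/2)" "(f ^^ m) z \<in> critical_points {0..1} f"
      using m unfolding is_net_def by fastforce
    have zab: "z \<in> {a<..<b}" using z(1) ab(3) by (auto simp: dist_real_def abs_if field_simps split: if_splits)
    \<comment> \<open>The one iterate beyond \<open>m\<close> gives injectivity both of
      \<open>f ^^ m\<close> on the interval and of \<open>f\<close> on its image.\<close>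
    have inj: "inj_on (f \<circ> f ^^ m) {a<..<b}" using ab(2) by (auto intro: inj_on_subset)
    have "open ((f ^^ m) ` {a<..<b})"
    proof (rule invariance_of_domain)
      show "continuous_on {a<..<b} (f ^^ m)"
        by (rule continuous_on_subset[OF funpow_cont]) (use ab(1) in force)
      show "inj_on (f ^^ m) {a<..<b}" using inj by (rule inj_on_imageI2)
    qed auto
    moreover have "(f ^^ m) ` {a<..<b} \<subseteq> {0..1}"
      using ab(1) funpow_maps by (auto simp: subset_iff)
    ultimately have "openin (top_of_set {0..1}) ((f ^^ m) ` {a<..<b})"
      by (simp add: open_subset)
    moreover have "inj_on f ((f ^^ m) ` {a<..<b})" using inj by (rule inj_on_imageI)
    ultimately show False using z(2) zab unfolding critical_points_def by blast
  qed
qed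

text \<open>Over a fixed number of steps, uniform continuity controls the accumulated error, so
  \<open>\<delta>\<close> depends only on \<open>\<epsilon>\<close> and \<open>N\<close>, not on the
  pseudo-orbit.\<close>

lemma pseudo_orbit_near_orbit:
  assumes "\<epsilon> > 0"
  obtains \<delta> where "\<delta> > 0" "\<And>x. range x \<subseteq> {0..1} \<Longrightarrow> pseudo_orbit f \<delta> x \<Longrightarrow> \<forall>k\<le>N. dist ((f ^^ k) (x 0)) (x k) < \<epsilon>"
proof -
  have "\<exists>\<delta>>0. \<forall>x. range x \<subseteq> {0..1} \<and> pseudo_orbit f \<delta> x \<longrightarrow> (\<forall>k\<le>N. dist ((f ^^ k) (x 0)) (x k) < \<epsilon>)"
    using assms
  proof (induction N arbitrary: \<epsilon>)
    case 0
    then show ?case by (intro exI[of _ 1]) auto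
  next
    case (Suc N)
    have "uniformly_continuous_on {0..1} f"
      using compact_uniformly_continuous[OF cont] by simp
    then obtain d where d: "d > 0" "\<And>u v. u \<in> {0..1} \<Longrightarrow> v \<in> {0..1} \<Longrightarrow> dist u v < d \<Longrightarrow> dist (f u) (f v) < \<epsilon>/2"
      unfolding uniformly_continuous_on_def using Suc.prems by (metis half_gt_zero)
    \<comment> \<open>The bound \<open>d\<close> makes the error at time \<open>N\<close> contribute
      at most \<open>\<epsilon>/2\<close> after one application of \<open>f\<close>; the last jump
      contributes the other half.\<close>
    obtain \<delta> where \<delta>: "\<delta> > 0" "\<And>x. range x \<subseteq> {0..1} \<Longrightarrow> pseudo_orbit f \<delta> x \<Longrightarrow>
        \<forall>k\<le>N. dist ((f ^^ k) (x 0)) (x k) < min \<epsilon> d"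
      using Suc.IH[of "min \<epsilon> d"] Suc.prems d(1) by auto
    show ?case
    proof (intro exI[of _ "min \<delta> (\<epsilon>/2)"] conjI allI impI)
      show "min \<delta> (\<epsilon>/2) > 0" using \<delta> Suc.prems by auto
      fix x k assume x: "range x \<subseteq> {0..1} \<and> pseudo_orbit f (min \<delta> (\<epsilon>/2)) x" and k: "k \<le> Suc N"
      then have near: "\<forall>k\<le>N. dist ((f ^^ k) (x 0)) (x k) < min \<epsilon> d"
        using \<delta>(2)[of x] by (auto simp: pseudo_orbit_def)
      have "dist (f ((f ^^ N) (x 0))) (f (x N)) < \<epsilon>/2"
        using near x by (intro d(2) funpow_maps) (auto simp: image_subset_iff)
      moreover have "dist (f (x N)) (x (Suc N)) < \<epsilon>/2"
        using x by (auto simp: pseudo_orbit_def)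
      ultimately have "dist ((f ^^ Suc N) (x 0)) (x (Suc N)) < \<epsilon>"
        using dist_triangle_half_r[of "f (x N)" _ \<epsilon>] by (simp add: dist_commute)
      then show "dist ((f ^^ k) (x 0)) (x k) < \<epsilon>"
        using near k by (cases "k = Suc N") auto
    qed
  qed
  then show ?thesis by (elim exE conjE) (rule that, auto)
qed

end

section \<open>Uniform expansivity and openness along \<open>\<Lambda>\<close>\<close>

text \<open>The critical set enters through \<open>inj\<close>, which holds on collars of a uniform
  radius, and the net condition through \<open>small\<close>.\<close>

locale expansive_interval_map = interval_map +
  fixes \<Lambda> :: "real set" and \<eta> :: real
  assumes compact: "compact \<Lambda>" and invariant: "f ` \<Lambda> \<subseteq> \<Lambda>"
    and \<eta>_pos: "\<eta> > 0"
    and collar: "x \<in> \<Lambda> \<Longrightarrow> {x - \<eta>..x + \<eta>} \<subseteq> {0..1}"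
    and inj: "x \<in> \<Lambda> \<Longrightarrow> inj_on f {x - \<eta>..x + \<eta>}"
    and small: "\<epsilon> > 0 \<Longrightarrow> \<exists>N. \<forall>a b. {a..b} \<subseteq> {0..1} \<longrightarrow> inj_on (f ^^ N) {a..b} \<longrightarrow> b - a < \<epsilon>"
begin

lemma sub: "\<Lambda> \<subseteq> {0..1}"
  using collar \<eta>_pos by fastforce

lemma funpow_invariant: "x \<in> \<Lambda> \<Longrightarrow> (f ^^ n) x \<in> \<Lambda>"
  using invariant by (induction n) auto

text \<open>As long as the two orbits stay \<open>\<eta>\<close>-close, the image of the segment
  from \<open>x\<close> to \<open>y\<close> lies in the collar of a point of
  \<open>\<Lambda>\<close>, so one more iterate is injective on the segment. After \<open>N\<close>
  steps \<open>small\<close> bounds its length.\<close>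

lemma expansive:
  assumes "\<epsilon> > 0"
  obtains N where "\<And>x y. x \<in> \<Lambda> \<Longrightarrow> y \<in> {0..1} \<Longrightarrow> \<forall>k<N. dist ((f ^^ k) y) ((f ^^ k) x) \<le> \<eta> \<Longrightarrow> dist y x < \<epsilon>"
proof -
  obtain N where N: "\<And>a b. {a..b} \<subseteq> {0..1} \<Longrightarrow> inj_on (f ^^ N) {a..b} \<Longrightarrow> b - a < \<epsilon>"
    using small[OF assms] by blast
  show ?thesis
  proof (rule that)
    fix x y assume x: "x \<in> \<Lambda>" and y: "y \<in> {0..1}"
      and close: "\<forall>k<N. dist ((f ^^ k) y) ((f ^^ k) x) \<le> \<eta>"
    have seg: "closed_segment x y \<subseteq> {0..1}"
      using x y sub by (auto simp: closed_segment_eq_real_ivl split: if_splits)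
    have "inj_on (f ^^ k) (closed_segment x y)" if "k \<le> N" for k
      using that
    proof (induction k)
      case (Suc k)
      then have ik: "inj_on (f ^^ k) (closed_segment x y)" and "k < N" by auto
      \<comment> \<open>Injectivity so far makes the image exactly the segment between the image
        endpoints, so closeness of the endpoints confines all of it.\<close>
      have "(f ^^ k) ` closed_segment x y = closed_segment ((f ^^ k) x) ((f ^^ k) y)"
        using continuous_injective_image_segment_1[OF continuous_on_subset[OF funpow_cont seg] ik] .
      also have "\<dots> \<subseteq> {(f ^^ k) x - \<eta>..(f ^^ k) x + \<eta>}"
      proof -
        have "dist ((f ^^ k) y) ((f ^^ k) x) \<le> \<eta>" using close \<open>k < N\<close> by blast
        then show ?thesis
          using \<eta>_pos by (auto simp: closed_segment_eq_real_ivl dist_real_def split: if_splits)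
      qed
      finally have "inj_on f ((f ^^ k) ` closed_segment x y)"
        using inj[OF funpow_invariant[OF x]] by (rule inj_on_subset[rotated])
      then show ?case using comp_inj_on[OF ik, of f] by (simp add: comp_def)
    qed simp
    then have "inj_on (f ^^ N) (closed_segment x y)" by simp
    then show "dist y x < \<epsilon>"
      using N[of x y] N[of y x] seg
      by (auto simp: closed_segment_eq_real_ivl dist_real_def split: if_splits)
  qed
qed

text \<open>By strict monotonicity on the collar, \<open>f x\<close> lies strictly between the
  values at \<open>x - \<eta>/2\<close> and \<open>x + \<eta>/2\<close>, with a gap bounded below by
  compactness; intermediate values then supply the preimage. The radius \<open>\<eta>/2\<close>
  matches the tolerance in \<open>pseudo_expansive\<close>.\<close>

lemma uniformly_open:
  obtains \<rho> where "\<rho> > 0" "\<And>x z. x \<in> \<Lambda> \<Longrightarrow> dist z (f x) \<le> \<rho> \<Longrightarrow> \<exists>y\<in>{0..1}. dist y x \<le> \<eta>/2 \<and> f y = z"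
proof (cases "\<Lambda> = {}")
  case True
  then show ?thesis using that[of 1] by auto
next
  case False
  \<comment> \<open>The smaller of the two gaps around \<open>f x\<close>; its minimum over
    \<open>\<Lambda>\<close> is the required \<open>\<rho>\<close>.\<close>
  define g where "g x = min \<bar>f (x + \<eta>/2) - f x\<bar> \<bar>f (x - \<eta>/2) - f x\<bar>" for x
  have shift: "x \<in> {0..1}" "x + \<eta>/2 \<in> {0..1}" "x - \<eta>/2 \<in> {0..1}" if "x \<in> \<Lambda>" for x
  proof -
    have "x \<in> {x - \<eta>..x + \<eta>}" "x + \<eta>/2 \<in> {x - \<eta>..x + \<eta>}" "x - \<eta>/2 \<in> {x - \<eta>..x + \<eta>}"
      using \<eta>_pos by auto
    then show "x \<in> {0..1}" "x + \<eta>/2 \<in> {0..1}" "x - \<eta>/2 \<in> {0..1}"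
      using collar[OF that] by blast+
  qed
  have "continuous_on \<Lambda> g"
    unfolding g_def
    by (intro continuous_intros continuous_on_compose2[OF cont]) (use shift in auto)
  then obtain p where p: "p \<in> \<Lambda>" "\<And>x. x \<in> \<Lambda> \<Longrightarrow> g p \<le> g x"
    using continuous_attains_inf[OF compact False] by blast
  have mono: "f (x - \<eta>/2) < f x \<and> f x < f (x + \<eta>/2) \<or> f (x + \<eta>/2) < f x \<and> f x < f (x - \<eta>/2)"
    if "x \<in> \<Lambda>" for x
  proof (rule continuous_inj_imp_mono[of "x - \<eta>/2" x "x + \<eta>/2" f])
    have s: "{x - \<eta>/2..x + \<eta>/2} \<subseteq> {x - \<eta>..x + \<eta>}" using \<eta>_pos by auto
    show "inj_on f {x - \<eta>/2..x + \<eta>/2}" using inj[OF that] s by (rule inj_on_subset)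
    show "continuous_on {x - \<eta>/2..x + \<eta>/2} f"
      using cont s collar[OF that] by (meson continuous_on_subset order_trans)
  qed (use \<eta>_pos in auto)
  show ?thesis
  proof (rule that[of "g p"])
    show "g p > 0" using mono[OF p(1)] by (auto simp: g_def)
    fix x z assume x: "x \<in> \<Lambda>" and z: "dist z (f x) \<le> g p"
    have gx: "dist z (f x) \<le> g x" using z p(2)[OF x] by linarith
    have con: "connected {x - \<eta>/2..x + \<eta>/2}" by simp
    have s: "{x - \<eta>/2..x + \<eta>/2} \<subseteq> {0..1}" using shift[OF x] by auto
    have "connected (f ` {x - \<eta>/2..x + \<eta>/2})"
      by (rule connected_continuous_image[OF continuous_on_subset[OF cont s] con])
    moreover have "f (x - \<eta>/2) \<in> f ` {x - \<eta>/2..x + \<eta>/2}" "f (x + \<eta>/2) \<in> f ` {x - \<eta>/2..x + \<eta>/2}"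
      using \<eta>_pos by auto
    moreover have "f (x - \<eta>/2) \<le> z \<and> z \<le> f (x + \<eta>/2) \<or> f (x + \<eta>/2) \<le> z \<and> z \<le> f (x - \<eta>/2)"
      using mono[OF x] gx by (auto simp: g_def dist_real_def)
    ultimately have "z \<in> f ` {x - \<eta>/2..x + \<eta>/2}"
      by (meson connected_iff_interval)
    then obtain y where "y \<in> {x - \<eta>/2..x + \<eta>/2}" "f y = z" by blast
    then show "\<exists>y\<in>{0..1}. dist y x \<le> \<eta>/2 \<and> f y = z"
      using s by (intro bexI[of _ y]) (auto simp: dist_real_def abs_if)
  qed
qed

section \<open>Pulling back pseudo-orbits\<close>

text \<open>For small \<open>\<delta>\<close> the true orbit of \<open>x 0\<close> stays within
  \<open>\<eta>/2\<close> of the pseudo-orbit for \<open>N\<close> steps. Together with the assumed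
  \<open>\<eta>/2\<close> this meets the tolerance \<open>\<eta>\<close> of
  \<open>expansive\<close>.\<close>

lemma pseudo_expansive:
  assumes "\<epsilon> > 0"
  obtains N \<delta> where "\<delta> > 0"
    "\<And>x y. range x \<subseteq> \<Lambda> \<Longrightarrow> pseudo_orbit f \<delta> x \<Longrightarrow> y \<in> {0..1} \<Longrightarrow>
      \<forall>k<N. dist ((f ^^ k) y) (x k) \<le> \<eta>/2 \<Longrightarrow> dist y (x 0) < \<epsilon>"
proof -
  obtain N where N: "\<And>x y. x \<in> \<Lambda> \<Longrightarrow> y \<in> {0..1} \<Longrightarrow>
      \<forall>k<N. dist ((f ^^ k) y) ((f ^^ k) x) \<le> \<eta> \<Longrightarrow> dist y x < \<epsilon>"
    using expansive[OF assms] by blast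
  obtain \<delta> where \<delta>: "\<delta> > 0" "\<And>x. range x \<subseteq> {0..1} \<Longrightarrow> pseudo_orbit f \<delta> x \<Longrightarrow>
      \<forall>k\<le>N. dist ((f ^^ k) (x 0)) (x k) < \<eta>/2"
    using pseudo_orbit_near_orbit[of "\<eta>/2" N] \<eta>_pos by auto
  show ?thesis
  proof (rule that[OF \<delta>(1), of N])
    fix x y assume x: "range x \<subseteq> \<Lambda>" "pseudo_orbit f \<delta> x" and y: "y \<in> {0..1}"
      and close: "\<forall>k<N. dist ((f ^^ k) y) (x k) \<le> \<eta>/2"
    have near: "\<forall>k\<le>N. dist ((f ^^ k) (x 0)) (x k) < \<eta>/2"
      using \<delta>(2) x sub by blast
    show "dist y (x 0) < \<epsilon>"
    proof (rule N)
      show "x 0 \<in> \<Lambda>" using x by auto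
      show "\<forall>k<N. dist ((f ^^ k) y) ((f ^^ k) (x 0)) \<le> \<eta>"
      proof (intro allI impI)
        fix k assume "k < N"
        then show "dist ((f ^^ k) y) ((f ^^ k) (x 0)) \<le> \<eta>"
          using close near dist_triangle2[of "(f ^^ k) y" "(f ^^ k) (x 0)" "x k"] by (smt (verit) field_sum_of_halves less_imp_le)
      qed
    qed (rule y)
  qed
qed

text \<open>
  The pseudo-orbit is assumed to be a true orbit from time \<open>m\<close> on, so that
  \<open>pseudo_expansive\<close> applies at every stage of the pull-back, without a special treatment
  of the last few steps.
\<close>

lemma pull_back:
  assumes "\<epsilon> > 0"
  obtains \<delta> where "\<delta> > 0"
    "\<And>m x. range x \<subseteq> \<Lambda> \<Longrightarrow> pseudo_orbit f \<delta> x \<Longrightarrow> \<forall>n\<ge>m. x (Suc n) = f (x n) \<Longrightarrow>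
      \<exists>y\<in>{0..1}. shadows f \<epsilon> y x \<and> (f ^^ m) y = x m"
proof -
  obtain \<rho> where \<rho>: "\<rho> > 0" "\<And>x z. x \<in> \<Lambda> \<Longrightarrow> dist z (f x) \<le> \<rho> \<Longrightarrow>
      \<exists>y\<in>{0..1}. dist y x \<le> \<eta>/2 \<and> f y = z"
    using that by (rule uniformly_open)
  \<comment> \<open>The bound \<open>\<eta>/2\<close> lets the later points satisfy the hypothesis
    of \<open>pseudo_expansive\<close>; \<open>\<rho>/2\<close> plus a jump below
    \<open>\<rho>/2\<close> stays within reach of \<open>uniformly_open\<close>.\<close>
  define e where "e = min \<epsilon> (min (\<eta>/2) (\<rho>/2))"
  have e: "e > 0" "e \<le> \<epsilon>" "e \<le> \<eta>/2" "e \<le> \<rho>/2" using assms \<eta>_pos \<rho> by (auto simp: e_def)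
  obtain N \<delta> where \<delta>: "\<delta> > 0" "\<And>x y. range x \<subseteq> \<Lambda> \<Longrightarrow> pseudo_orbit f \<delta> x \<Longrightarrow> y \<in> {0..1} \<Longrightarrow>
      \<forall>k<N. dist ((f ^^ k) y) (x k) \<le> \<eta>/2 \<Longrightarrow> dist y (x 0) < e"
    using that by (rule pseudo_expansive[OF e(1)])
  show ?thesis
  proof (rule that[of "min \<delta> (\<rho>/2)"])
    show "min \<delta> (\<rho>/2) > 0" using \<delta> \<rho> by auto
    fix m x assume "range x \<subseteq> \<Lambda>" "pseudo_orbit f (min \<delta> (\<rho>/2)) x" "\<forall>n\<ge>m. x (Suc n) = f (x n)"
    \<comment> \<open>Induction on \<open>m\<close> drops the first term and carries the bound
      \<open>e\<close>, which is small enough to feed the next step.\<close>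
    then have "\<exists>y\<in>{0..1}. shadows f e y x \<and> (f ^^ m) y = x m"
    proof (induction m arbitrary: x)
      case 0
      have "(f ^^ n) (x 0) = x n" for n using 0(3) by (induction n) auto
      moreover have "x 0 \<in> {0..1}" using 0(1) sub by blast
      ultimately show ?case using e(1) by (intro bexI[of _ "x 0"]) (auto simp: shadows_def)
    next
      case (Suc m)
      have "\<exists>y\<in>{0..1}. shadows f e y (\<lambda>n. x (Suc n)) \<and> (f ^^ m) y = x (Suc m)"
        using Suc.prems by (intro Suc.IH) (auto simp: pseudo_orbit_def)
      then obtain y where y: "y \<in> {0..1}" "\<And>n. dist ((f ^^ n) y) (x (Suc n)) < e" "(f ^^ m) y = x (Suc m)"
        by (auto simp: shadows_def)
      have "dist (f (x 0)) (x (Suc 0)) < \<rho>/2" using Suc.prems(2) by (auto simp: pseudo_orbit_def)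
      moreover have "dist y (x (Suc 0)) < e" using y(2)[of 0] by simp
      ultimately have "dist y (f (x 0)) \<le> \<rho>"
        using e(4) dist_triangle2[of y "f (x 0)" "x (Suc 0)"] by linarith
      then obtain z where z: "z \<in> {0..1}" "dist z (x 0) \<le> \<eta>/2" "f z = y"
        using \<rho>(2) Suc.prems(1) by blast
      have later: "(f ^^ Suc n) z = (f ^^ n) y" for n
        using z(3) by (simp add: funpow_swap1)
      have "dist ((f ^^ k) z) (x k) \<le> \<eta>/2" for k
      proof (cases k)
        case (Suc n)
        then show ?thesis using y(2)[of n] e(3) later[of n] by simp
      qed (use z in simp)
      moreover have "pseudo_orbit f \<delta> x" using Suc.prems(2) by (auto simp: pseudo_orbit_def)
      \<comment> \<open>Expansivity turns the crude \<open>\<eta>/2\<close> at time 0 back into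
        \<open>e\<close>, so errors do not accumulate from step to step.\<close>
      ultimately have z0: "dist z (x 0) < e" using \<delta>(2) Suc.prems(1) z(1) by blast
      have "dist ((f ^^ k) z) (x k) < e" for k
      proof (cases k)
        case (Suc n)
        then show ?thesis using y(2)[of n] later[of n] by simp
      qed (use z0 in simp)
      then show ?case using z(1) y(3) later[of m] unfolding shadows_def by metis
    qed
    then show "\<exists>y\<in>{0..1}. shadows f \<epsilon> y x \<and> (f ^^ m) y = x m"
      using e(2) unfolding shadows_def by (meson less_le_trans)
  qed
qed

text \<open>Continuing the finite sequence by the true orbit of its last point keeps it in
  \<open>\<Lambda>\<close> and adds no jumps, so \<open>pull_back\<close> applies.\<close>

lemma finite_pull_back:
  assumes "\<epsilon> > 0"
  obtains \<delta> where "\<delta> > 0"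
    "\<And>m x. x ` {..m} \<subseteq> \<Lambda> \<Longrightarrow> finite_pseudo_orbit f \<delta> m x \<Longrightarrow>
      \<exists>y\<in>{0..1}. (\<forall>i\<le>m. dist ((f ^^ i) y) (x i) < \<epsilon>) \<and> (f ^^ m) y = x m"
proof -
  obtain \<delta> where \<delta>: "\<delta> > 0"
    "\<And>m x. range x \<subseteq> \<Lambda> \<Longrightarrow> pseudo_orbit f \<delta> x \<Longrightarrow> \<forall>n\<ge>m. x (Suc n) = f (x n) \<Longrightarrow>
      \<exists>y\<in>{0..1}. shadows f \<epsilon> y x \<and> (f ^^ m) y = x m"
    using that by (rule pull_back[OF assms])
  show ?thesis
  proof (rule that[OF \<delta>(1)])
    fix m x assume x: "x ` {..m} \<subseteq> \<Lambda>" "finite_pseudo_orbit f \<delta> m x"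
    define x' where "x' n = (if n \<le> m then x n else (f ^^ (n - m)) (x m))" for n
    have tail: "x' (Suc n) = f (x' n)" if "n \<ge> m" for n
      using that by (auto simp: x'_def Suc_diff_le)
    have "range x' \<subseteq> \<Lambda>" using x(1) funpow_invariant by (auto simp: x'_def)
    moreover have "pseudo_orbit f \<delta> x'"
      unfolding pseudo_orbit_def
    proof
      fix n show "dist (f (x' n)) (x' (Suc n)) < \<delta>"
      proof (cases "n < m")
        case True
        then show ?thesis using x(2) by (auto simp: x'_def finite_pseudo_orbit_def)
      next
        case False
        then show ?thesis using tail \<delta>(1) by simp
      qed
    qed
    ultimately obtain y where "y \<in> {0..1}" "shadows f \<epsilon> y x'" "(f ^^ m) y = x' m"
      using \<delta>(2)[of x' m] tail by blast
    then show "\<exists>y\<in>{0..1}. (\<forall>i\<le>m. dist ((f ^^ i) y) (x i) < \<epsilon>) \<and> (f ^^ m) y = x m"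
      unfolding shadows_def x'_def by (metis order_refl)
  qed
qed

section \<open>The three shadowing properties\<close>

lemma h_shadowing: "h_shadowing_on {0..1} f \<Lambda>"
  unfolding h_shadowing_on_def
proof (intro allI impI)
  fix \<epsilon> :: real assume "\<epsilon> > 0"
  obtain \<delta> where "\<delta> > 0"
    "\<And>m x. x ` {..m} \<subseteq> \<Lambda> \<Longrightarrow> finite_pseudo_orbit f \<delta> m x \<Longrightarrow>
      \<exists>y\<in>{0..1}. (\<forall>i\<le>m. dist ((f ^^ i) y) (x i) < \<epsilon>) \<and> (f ^^ m) y = x m"
    using that by (rule finite_pull_back[OF \<open>\<epsilon> > 0\<close>])
  then show "\<exists>\<delta>>0. \<forall>m x. x ` {..m} \<subseteq> \<Lambda> \<and> finite_pseudo_orbit f \<delta> m x \<longrightarrow>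
      (\<exists>y\<in>{0..1}. (\<forall>i<m. dist ((f ^^ i) y) (x i) < \<epsilon>) \<and> (f ^^ m) y = x m)"
    by (intro exI[of _ \<delta>]) (meson less_imp_le)
qed

text \<open>Points \<open>y m\<close> shadow the initial pieces up to \<open>m\<close>; by
  continuity of each iterate, a limit point of them shadows the whole sequence. The limit only
  preserves a weak inequality, hence the start from \<open>\<epsilon>/2\<close>.\<close>

lemma shadowing: "shadowing_on {0..1} f \<Lambda>"
  unfolding shadowing_on_def
proof (intro allI impI)
  fix \<epsilon> :: real assume "\<epsilon> > 0"
  then have "\<epsilon>/2 > 0" by simp
  then obtain \<delta> where \<delta>: "\<delta> > 0"
    "\<And>m x. x ` {..m} \<subseteq> \<Lambda> \<Longrightarrow> finite_pseudo_orbit f \<delta> m x \<Longrightarrow>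
      \<exists>y\<in>{0..1}. (\<forall>i\<le>m. dist ((f ^^ i) y) (x i) < \<epsilon>/2) \<and> (f ^^ m) y = x m"
    using that by (rule finite_pull_back)
  show "\<exists>\<delta>>0. \<forall>x. range x \<subseteq> \<Lambda> \<and> pseudo_orbit f \<delta> x \<longrightarrow> (\<exists>y\<in>{0..1}. shadows f \<epsilon> y x)"
  proof (intro exI[of _ \<delta>] conjI allI impI, fact)
    fix x assume x: "range x \<subseteq> \<Lambda> \<and> pseudo_orbit f \<delta> x"
    have "\<exists>y\<in>{0..1}. \<forall>i\<le>m. dist ((f ^^ i) y) (x i) < \<epsilon>/2" for m
      using \<delta>(2)[of x m] x by (auto simp: pseudo_orbit_def finite_pseudo_orbit_def image_subset_iff)
    then obtain y where y: "\<And>m. y m \<in> {0..1}" "\<And>m i. i \<le> m \<Longrightarrow> dist ((f ^^ i) (y m)) (x i) < \<epsilon>/2"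
      by metis
    obtain l r where l: "l \<in> {0..1}" "strict_mono r" "(y \<circ> r) \<longlonglongrightarrow> l"
      using compact_Icc[of "0::real" 1] y(1) unfolding compact_def by metis
    have "dist ((f ^^ i) l) (x i) \<le> \<epsilon>/2" for i
    proof (rule tendsto_upperbound)
      have "(\<lambda>n. (f ^^ i) ((y \<circ> r) n)) \<longlonglongrightarrow> (f ^^ i) l"
        by (rule continuous_on_tendsto_compose[OF funpow_cont l(3,1)]) (simp add: y(1)[simplified])
      then show "(\<lambda>n. dist ((f ^^ i) ((y \<circ> r) n)) (x i)) \<longlonglongrightarrow> dist ((f ^^ i) l) (x i)"
        by (intro tendsto_intros)
      \<comment> \<open>Since \<open>r n \<ge> n \<ge> i\<close>, the point \<open>y (r n)\<close>
        already controls index \<open>i\<close>.\<close>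
      have "dist ((f ^^ i) ((y \<circ> r) n)) (x i) \<le> \<epsilon>/2" if "n \<ge> i" for n
        using y(2)[of i "r n"] seq_suble[OF l(2), of n] that by force
      then show "\<forall>\<^sub>F n in sequentially. dist ((f ^^ i) ((y \<circ> r) n)) (x i) \<le> \<epsilon>/2"
        by (auto intro: eventually_sequentiallyI)
    qed simp
    then have "shadows f \<epsilon> l x"
      unfolding shadows_def using \<open>\<epsilon> > 0\<close> by (smt (verit) field_sum_of_halves)
    then show "\<exists>y\<in>{0..1}. shadows f \<epsilon> y x" using l(1) by blast
  qed
qed

text \<open>For every \<open>\<delta>\<close>, a late enough tail is a
  \<open>\<delta>\<close>-pseudo-orbit that the shifted orbit of \<open>y\<close> follows within
  \<open>\<eta>/2\<close> forever. Applying \<open>pseudo_expansive\<close> to the tail from each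
  late \<open>n\<close> makes the distance at \<open>n\<close> arbitrarily small.\<close>

lemma asymptotic_if_shadows:
  assumes x: "range x \<subseteq> \<Lambda>" "(\<lambda>n. dist (f (x n)) (x (Suc n))) \<longlonglongrightarrow> 0"
    and y: "y \<in> {0..1}" "shadows f (\<eta>/2) y x"
  shows "(\<lambda>n. dist ((f ^^ n) y) (x n)) \<longlonglongrightarrow> 0"
proof (rule metric_LIMSEQ_I)
  fix \<epsilon> :: real assume "\<epsilon> > 0"
  obtain N \<delta> where \<delta>: "\<delta> > 0" "\<And>x y. range x \<subseteq> \<Lambda> \<Longrightarrow> pseudo_orbit f \<delta> x \<Longrightarrow> y \<in> {0..1} \<Longrightarrow>
      \<forall>k<N. dist ((f ^^ k) y) (x k) \<le> \<eta>/2 \<Longrightarrow> dist y (x 0) < \<epsilon>"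
    using that by (rule pseudo_expansive[OF \<open>\<epsilon> > 0\<close>])
  obtain n0 where n0: "\<And>n. n \<ge> n0 \<Longrightarrow> dist (f (x n)) (x (Suc n)) < \<delta>"
    using metric_LIMSEQ_D[OF x(2) \<delta>(1)] by auto
  have "dist ((f ^^ n) y) (x n) < \<epsilon>" if "n \<ge> n0" for n
  proof -
    have "dist ((f ^^ k) ((f ^^ n) y)) (x (n + k)) \<le> \<eta>/2" for k
      using y(2)[unfolded shadows_def, rule_format, of "n + k"]
      by (simp add: funpow_add[of k n f, unfolded comp_def, THEN fun_cong, symmetric] add.commute)
    then have "dist ((f ^^ n) y) (x (n + 0)) < \<epsilon>"
      using \<delta>(2)[of "\<lambda>k. x (n + k)" "(f ^^ n) y"] x(1) n0 that funpow_maps[OF y(1)]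
      by (auto simp: pseudo_orbit_def)
    then show ?thesis by simp
  qed
  then show "\<exists>n0. \<forall>n\<ge>n0. dist (dist ((f ^^ n) y) (x n)) 0 < \<epsilon>" by (auto simp: dist_real_def)
qed

lemma s_limit_shadowing: "s_limit_shadowing_on {0..1} f \<Lambda>"
  unfolding s_limit_shadowing_on_def
proof (intro allI impI)
  fix \<epsilon> :: real assume "\<epsilon> > 0"
  \<comment> \<open>Shadowing within \<open>\<eta>/2\<close> becomes asymptotic by itself, so one
    \<open>\<delta>\<close> and the same point \<open>y\<close> serve the second clause.\<close>
  define e where "e = min \<epsilon> (\<eta>/2)"
  have e: "e > 0" "e \<le> \<epsilon>" "e \<le> \<eta>/2" using \<open>\<epsilon> > 0\<close> \<eta>_pos by (auto simp: e_def)
  obtain \<delta> where \<delta>: "\<delta> > 0"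
    "\<And>x. range x \<subseteq> \<Lambda> \<Longrightarrow> pseudo_orbit f \<delta> x \<Longrightarrow> \<exists>y\<in>{0..1}. shadows f e y x"
    using shadowing[unfolded shadowing_on_def, rule_format, OF e(1)] by auto
  have weaken: "shadows f d y x" if "shadows f e y x" "e \<le> d" for d y x
    using that unfolding shadows_def by (meson less_le_trans)
  show "\<exists>\<delta>>0. (\<forall>x. range x \<subseteq> \<Lambda> \<and> pseudo_orbit f \<delta> x \<longrightarrow> (\<exists>y\<in>{0..1}. shadows f \<epsilon> y x)) \<and>
      (\<forall>x. range x \<subseteq> \<Lambda> \<and> asymptotic_pseudo_orbit f \<delta> x \<longrightarrow>
        (\<exists>y\<in>{0..1}. asymptotically_shadows f \<epsilon> y x))"
  proof (intro exI[of _ \<delta>] conjI allI impI)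
    fix x assume "range x \<subseteq> \<Lambda> \<and> pseudo_orbit f \<delta> x"
    then show "\<exists>y\<in>{0..1}. shadows f \<epsilon> y x" using \<delta>(2) weaken e(2) by blast
  next
    fix x assume x: "range x \<subseteq> \<Lambda> \<and> asymptotic_pseudo_orbit f \<delta> x"
    then obtain y where y: "y \<in> {0..1}" "shadows f e y x"
      using \<delta>(2) unfolding asymptotic_pseudo_orbit_def by blast
    have "(\<lambda>n. dist ((f ^^ n) y) (x n)) \<longlonglongrightarrow> 0"
      using x y(1) weaken[OF y(2) e(3)]
      by (intro asymptotic_if_shadows) (auto simp: asymptotic_pseudo_orbit_def)
    then have "asymptotically_shadows f \<epsilon> y x"
      using weaken[OF y(2) e(2)] by (simp add: asymptotically_shadows_def)
    then show "\<exists>y\<in>{0..1}. asymptotically_shadows f \<epsilon> y x" using y(1) by blast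
  qed (fact \<delta>(1))
qed

end

section \<open>Uniform collars from the hypotheses on critical points\<close>

theorem theorem5p6:
  fixes f :: "real \<Rightarrow> real" and C \<Lambda> :: "real set"
  assumes "continuous_on {0..1} f" and "f ` {0..1} \<subseteq> {0..1}"
    and "C = critical_points {0..1} f"
    and "\<Lambda> \<subseteq> {0<..<1}" and "closed \<Lambda>" and "f ` \<Lambda> = \<Lambda>"
    and "closed C"
    and "\<forall>\<epsilon>>0. \<exists>m::nat. m > 0 \<and> is_net \<epsilon> {0..1} {x \<in> {0..1}. (f ^^ m) x \<in> C}"
    and "\<forall>x \<in> {0..1} - C. schwarzian_defined {0..1} f x \<and> schwarzian {0..1} f x \<le> 0"
    and "\<Lambda> \<inter> C = {}"
  shows "shadowing_on {0..1} f \<Lambda> \<and> s_limit_shadowing_on {0..1} f \<Lambda> \<and> h_shadowing_on {0..1} f \<Lambda>"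
proof -
  interpret interval_map f by unfold_locales fact+
  have "bounded \<Lambda>"
    by (rule bounded_subset[of "{0<..<1::real}"]) (use assms(4) in auto)
  then have compact: "compact \<Lambda>" using assms(5) by (simp add: compact_eq_bounded_closed)
  have "\<Lambda> \<subseteq> {0<..<1} - C" using assms(4,10) by auto
  moreover have "open ({0<..<1} - C)" using assms(7) by (simp add: open_Diff)
  \<comment> \<open>Compactness of \<open>\<Lambda>\<close> inside the open complement of
    \<open>C\<close> gives one radius for all its points; this \<open>e\<close> becomes the
    \<open>\<eta>\<close> of the locale.\<close>
  ultimately obtain e where e: "e > 0" "(\<Union>x\<in>\<Lambda>. cball x e) \<subseteq> {0<..<1} - C"
    using compact_subset_open_imp_cball_epsilon_subset[OF compact, of "{0<..<1} - C"] by metis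
  have collar: "{x - e..x + e} \<subseteq> {0<..<1} - C" if "x \<in> \<Lambda>" for x
    using e(2) that by (auto simp: cball_eq_atLeastAtMost)
  have collar01: "{x - e..x + e} \<subseteq> {0..1}" if "x \<in> \<Lambda>" for x
    using collar[OF that] by fastforce
  interpret expansive_interval_map f \<Lambda> e
  proof
    show "compact \<Lambda>" by fact
    show "f ` \<Lambda> \<subseteq> \<Lambda>" using assms(6) by simp
    show "e > 0" by fact
    show "{x - e..x + e} \<subseteq> {0..1}" if "x \<in> \<Lambda>" for x by (rule collar01[OF that])
    show "inj_on f {x - e..x + e}" if "x \<in> \<Lambda>" for x
      using inj_on_if_no_critical_points[OF assms(1) collar01[OF that]] collar[OF that] assms(3) by blast
    show "\<exists>N. \<forall>a b. {a..b} \<subseteq> {0..1} \<longrightarrow> inj_on (f ^^ N) {a..b} \<longrightarrow> b - a < \<epsilon>"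
      if "\<epsilon> > 0" for \<epsilon>
      by (rule inj_iterate_small[OF assms(8)[unfolded assms(3)] that]) blast
  qed
  show ?thesis by (intro conjI shadowing s_limit_shadowing h_shadowing)
qed

end
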